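(* Let $(R_n(x))_{n\ge 1}$ be the alternating runs polynomials (of type $A$), i.e. $R_n(x)=\sum_{k}R(n,k)x^k$ where $R(1,0)=1$, $R(1,k)=0$ for $k\ge 1$ and $R(n,k)=kR(n-1,k)+2R(n-1,k-1)+(n-k)R(n-1,k-2)$; equivalently $R_1(x)=1$, $R_2(x)=2x$ and $$R_{n+2}(x)=x(nx+2)R_{n+1}(x)+x(1-x^2)\,\frac{d}{dx}R_{n+1}(x).$$ Then the Turán expressions $(R_{n+1}(x))^2-R_{n+2}(x)R_n(x)$ are Hurwitz stable for all $n\ge 1$.
   Context: A polynomial $f\in\mathbb{C}[x]$ is Hurwitz stable if it is identically zero or $f(x)\ne0$ whenever $\Re(x)>0$. Combinatorially, $R(n,k)$ is the number of permutations of $\{1,\dots,n\}$ with $k$ alternating runs, i.e. with $k-1$ indices $i\in\{2,\dots,n-1\}$ such that $\pi_{i-1}<\pi_i>\pi_{i+1}$ or $\pi_{i-1}>\pi_i<\pi_{i+1}$ (for $n\ge 2$). *)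

theory Defs
  imports Complex_Main "HOL-Computational_Algebra.Polynomial"
begin

definition hurwitz_stable :: "complex poly \<Rightarrow> bool" where
  "hurwitz_stable f \<longleftrightarrow> f = 0 \<or> (\<forall>z. Re z > 0 \<longrightarrow> poly f z \<noteq> 0)"

text \<open>
  The numbers \<open>R(n,k)\<close> are indexed by \<open>n \<ge> 1\<close>; the row \<open>n = 0\<close> is a dummy value.
  Entries with negative second index are zero, whence the two conditionals.
  The factor \<open>n - k\<close> is an integer difference.
\<close>

fun alt_runs :: "nat \<Rightarrow> nat \<Rightarrow> int" where
  "alt_runs 0 k = 0"
| "alt_runs (Suc 0) k = (if k = 0 then 1 else 0)"
| "alt_runs (Suc (Suc m)) k =
     int k * alt_runs (Suc m) k
     + 2 * (if k \<ge> 1 then alt_runs (Suc m) (k - 1) else 0)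
     + (int (Suc (Suc m)) - int k) * (if k \<ge> 2 then alt_runs (Suc m) (k - 2) else 0)"

lemma alt_runs_eq_0: "k \<ge> n \<Longrightarrow> alt_runs n k = 0"
proof (induction n k rule: alt_runs.induct)
  case (3 m k)
  show ?case
  proof (cases "k = Suc (Suc m)")
    case False
    with 3 have "k - 2 \<ge> Suc m" by simp
    then show ?thesis using 3 by simp
  qed (use 3 in simp)
qed auto

text \<open>By the preceding lemma the sum may be cut off at \<open>k = n\<close>.\<close>

definition alt_runs_poly :: "nat \<Rightarrow> complex poly" where
  "alt_runs_poly n = (\<Sum>k\<le>n. monom (of_int (alt_runs n k)) k)"

lemma coeff_alt_runs_poly: "coeff (alt_runs_poly n) k = of_int (alt_runs n k)"
  by (cases "k \<le> n") (simp_all add: alt_runs_poly_def coeff_sum alt_runs_eq_0)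

lemma alt_runs_poly_1: "alt_runs_poly 1 = 1"
  by (rule poly_eqI) (simp add: coeff_alt_runs_poly)

lemma alt_runs_poly_2: "alt_runs_poly 2 = [:0, 2:]"
  by (rule poly_eqI)
     (auto simp: coeff_alt_runs_poly numeral_2_eq_2 coeff_pCons split: nat.splits)

lemma alt_runs_poly_rec:
  "alt_runs_poly (n + 2) =
     [:0, 2, of_nat n:] * alt_runs_poly (n + 1) + [:0, 1, 0, -1:] * pderiv (alt_runs_poly (n + 1))"
proof (rule poly_eqI)
  fix k
  consider "k = 0" | "k = 1" | j where "k = Suc (Suc j)"
    by (metis One_nat_def not0_implies_Suc)
  then show "coeff (alt_runs_poly (n + 2)) k = coeff ([:0, 2, of_nat n:] * alt_runs_poly (n + 1)
       + [:0, 1, 0, -1:] * pderiv (alt_runs_poly (n + 1))) k"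
  proof cases
    case 3
    then show ?thesis
      by (cases j) (simp_all add: coeff_alt_runs_poly coeff_pCons coeff_pderiv algebra_simps)
  qed (simp_all add: coeff_alt_runs_poly coeff_pCons coeff_pderiv algebra_simps)
qed

end

theory Submission
  imports Defs "HOL-Computational_Algebra.Fundamental_Theorem_Algebra"
begin

text \<open>
  Write \<open>R\<^sub>n = c (1 + x)\<^sup>m \<Prod>\<^sub>i (x + a\<^sub>i)\<close> with all \<open>a\<^sub>i\<close> in \<open>[0, 1]\<close>. The recurrence becomes
  \<open>R\<^sub>n\<^sub>+\<^sub>1 = (1 + x) k R\<^sub>n\<close> with \<open>k = \<Sum>\<^sub>i (1 + a\<^sub>i) x / (x + a\<^sub>i) + e x / (x + 1)\<close> and \<open>e = 2 m + 3 - n\<close>.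
  As long as \<open>m\<close> is large enough for \<open>e \<ge> 0\<close>, the function \<open>k / x\<close> has no zero outside
  \<open>[-1, 0]\<close>, so that the shape of \<open>R\<^sub>n\<close> is inherited by \<open>R\<^sub>n\<^sub>+\<^sub>1\<close>. Moreover
  \<open>R\<^sub>n\<^sub>+\<^sub>1\<^sup>2 - R\<^sub>n\<^sub>+\<^sub>2 R\<^sub>n = - x (1 + x) R\<^sub>n\<^sup>2 (k + (1 - x\<^sup>2) k')\<close>, and the last factor does not vanish
  for \<open>Re x > 0\<close>: for real \<open>x\<close> it is positive, and otherwise the imaginary part of
  \<open>(1 - x\<^sup>2) k' cnj k\<close> has the sign opposite to that of \<open>Im x\<close>, because this is true of
  the contribution of each pair \<open>{i, j}\<close> to that product.
\<close>

section \<open>Sums of simple fractions\<close>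

text \<open>For \<open>p, a, b \<ge> 0\<close> the only summand that is not visibly nonnegative is \<open>a\<^sup>2 - a b + b\<^sup>2\<close>.\<close>

lemma Im_cross_numerator:
  fixes z :: complex and a b :: real
  defines "p \<equiv> Re z" and "q \<equiv> Im z"
  defines "s \<equiv> p\<^sup>2 + q\<^sup>2"
  shows "Im ((1 - z\<^sup>2) * cnj z * (cnj z + a) * (cnj z + b) *
           (a * (cnj z + a) * (z + b)\<^sup>2 + b * (cnj z + b) * (z + a)\<^sup>2)) =
         - 2 * q * ((a\<^sup>2 - a*b + b\<^sup>2) * (s\<^sup>2 + s^3) + 8*a*b*p\<^sup>2*s + a^3*b^3*(1 + s)
           + a\<^sup>2*b\<^sup>2*(2*s\<^sup>2 + 2*s + 8*p\<^sup>2) + p*a\<^sup>2*b\<^sup>2*(a + b)*(3 + 2*s)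
           + p*a*b*(a + b)*(4*s + 4*p\<^sup>2 + s\<^sup>2) + p*(a + b + a^3 + b^3)*s\<^sup>2
           + 2*p\<^sup>2*a*b*(a\<^sup>2 + b\<^sup>2)*(1 + s))"
proof -
  have z: "z = Complex p q"
    by (simp add: p_def q_def)
  show ?thesis
    unfolding s_def z complex_of_real_def complex_cnj
    by (simp add: power2_eq_square) algebra
qed

text \<open>Since \<open>a / (z + a)\<^sup>2\<close> is the derivative of
  \<open>z / (z + a)\<close>, these are the unweighted terms of the expanded product
  \<open>(1 - z\<^sup>2) * k' * cnj k\<close>.\<close>

definition cross_term :: "complex \<Rightarrow> real \<Rightarrow> real \<Rightarrow> complex" where
  "cross_term z a b = (1 - z\<^sup>2) * (a / (z + a)\<^sup>2) * cnj (z / (z + b))"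

lemma add_of_real_nonzero:
  fixes z :: complex
  assumes "Re z > 0" "a \<ge> 0"
  shows "z + of_real a \<noteq> 0"
proof
  assume "z + of_real a = 0"
  then have "Re (z + of_real a) = 0" by simp
  with assms show False by simp
qed

text \<open>A common denominator built from absolute values is real and positive, so the sign of the
  imaginary part is decided by the numerator, which \<open>Im_cross_numerator\<close>
  computes.\<close>

lemma cross_term_sym:
  assumes "Re z > 0" "a \<ge> 0" "b \<ge> 0"
  shows "cross_term z a b + cross_term z b a =
     (1 - z\<^sup>2) * cnj z * (cnj z + a) * (cnj z + b) *
       (a * (cnj z + a) * (z + b)\<^sup>2 + b * (cnj z + b) * (z + a)\<^sup>2)
     / of_real ((cmod (z + a))^4 * (cmod (z + b))^4)"
proof -
  have nz: "z + of_real a \<noteq> 0" "z + of_real b \<noteq> 0"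
    using assms by (simp_all add: add_of_real_nonzero)
  then have "cnj (z + of_real a) \<noteq> 0" "cnj (z + of_real b) \<noteq> 0"
    by (simp_all only: complex_cnj_zero_iff not_False_eq_True)
  then have nzc: "cnj z + of_real a \<noteq> 0" "cnj z + of_real b \<noteq> 0"
    by simp_all
  have cmod4: "complex_of_real ((cmod w)^4) = w\<^sup>2 * (cnj w)\<^sup>2" for w
  proof -
    have "complex_of_real ((cmod w)^4) = (complex_of_real ((cmod w)\<^sup>2))\<^sup>2"
      by simp
    also have "\<dots> = w\<^sup>2 * (cnj w)\<^sup>2"
      by (simp only: complex_norm_square power_mult_distrib)
    finally show ?thesis .
  qed
  show ?thesis
    unfolding cross_term_def of_real_mult cmod4
    using nz nzc by (simp add: divide_simps) (simp add: algebra_simps power2_eq_square)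
qed

text \<open>Strictness comes from \<open>a\<^sup>2 - a*b + b\<^sup>2\<close>, half a sum of three
  squares, which is positive unless \<open>a\<close> and \<open>b\<close> both vanish.\<close>

lemma cross_term_sym_neg:
  assumes z: "Re z > 0" "Im z \<noteq> 0" and ab: "a \<ge> 0" "b \<ge> 0" "a \<noteq> 0 \<or> b \<noteq> 0"
  shows "Im z * Im (cross_term z a b + cross_term z b a) < 0"
proof -
  define p where "p = Re z"
  define q where "q = Im z"
  define s where "s = p\<^sup>2 + q\<^sup>2"
  define S where "S = (a\<^sup>2 - a*b + b\<^sup>2) * (s\<^sup>2 + s^3) + (8*a*b*p\<^sup>2*s + a^3*b^3*(1 + s)
           + a\<^sup>2*b\<^sup>2*(2*s\<^sup>2 + 2*s + 8*p\<^sup>2) + p*a\<^sup>2*b\<^sup>2*(a + b)*(3 + 2*s)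
           + p*a*b*(a + b)*(4*s + 4*p\<^sup>2 + s\<^sup>2) + p*(a + b + a^3 + b^3)*s\<^sup>2
           + 2*p\<^sup>2*a*b*(a\<^sup>2 + b\<^sup>2)*(1 + s))"
  define D where "D = (cmod (z + a))^4 * (cmod (z + b))^4"
  have D: "D > 0"
    using z ab by (auto simp: D_def intro!: mult_pos_pos zero_less_power dest: add_of_real_nonzero)
  have p: "p > 0" and q: "q \<noteq> 0" and s: "s > 0"
    using z by (auto simp: p_def q_def s_def sum_power2_gt_zero_iff)
  have "a\<^sup>2 - a*b + b\<^sup>2 = ((a - b)\<^sup>2 + a\<^sup>2 + b\<^sup>2) / 2"
    by (simp add: power2_eq_square algebra_simps)
  also have "\<dots> > 0"
    using ab(3) by (smt (verit) half_gt_zero zero_less_power2 zero_le_power2)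
  finally have "(a\<^sup>2 - a*b + b\<^sup>2) * (s\<^sup>2 + s^3) > 0"
    using s by (simp add: add_pos_pos)
  then have S: "S > 0"
    unfolding S_def using p s ab by (intro add_pos_nonneg add_nonneg_nonneg) auto
  have "Im (cross_term z a b + cross_term z b a) = (- 2 * q * S) / D"
    unfolding cross_term_sym[OF z(1) ab(1,2)] Im_divide_of_real Im_cross_numerator
    by (simp add: S_def D_def p_def q_def s_def algebra_simps)
  then have "Im z * Im (cross_term z a b + cross_term z b a) = - (2 * q\<^sup>2 * S / D)"
    by (simp add: q_def power2_eq_square)
  also have "\<dots> < 0"
    using q S D by simp
  finally show ?thesis .
qed

text \<open>After division by \<open>z\<close>, the imaginary parts of the terms
  \<open>e i / (z + a i)\<close> all have the sign opposite to that of \<open>Im z\<close>; for real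
  \<open>z\<close> outside [-1, 0] the denominators share one sign.\<close>

lemma stieltjes_sum_nonzero:
  fixes e a :: "'i \<Rightarrow> real" and z :: complex
  assumes "finite I" and e: "\<And>i. i \<in> I \<Longrightarrow> e i \<ge> 0" "\<exists>i\<in>I. e i > 0"
    and a: "\<And>i. i \<in> I \<Longrightarrow> a i \<in> {0..1}"
    and z: "\<nexists>t. t \<in> {0..1} \<and> z = - of_real t"
  shows "(\<Sum>i\<in>I. e i * (z / (z + a i))) \<noteq> 0"
proof -
  define h where "h = (\<Sum>i\<in>I. e i / (z + a i))"
  obtain i0 where i0: "i0 \<in> I" "e i0 > 0"
    using e(2) by blast
  have nz: "z + a i \<noteq> 0" if "i \<in> I" for i
    using z a[OF that] by (metis add_eq_0_iff2)
  have "h \<noteq> 0"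
  proof (cases "Im z = 0")
    case False
    have term_eq: "- Im z * Im (e i / (z + a i)) = e i * ((Im z)\<^sup>2 / (cmod (z + a i))\<^sup>2)" for i
      by (simp add: Im_divide cmod_power2) (simp add: power2_eq_square)
    have "- Im z * Im h = (\<Sum>i\<in>I. e i * ((Im z)\<^sup>2 / (cmod (z + a i))\<^sup>2))"
      unfolding h_def Im_sum sum_distrib_left term_eq ..
    also have "\<dots> > 0"
      using \<open>finite I\<close> i0 e(1) False nz[OF i0(1)] by (intro sum_pos2[of _ i0]) auto
    finally show ?thesis by auto
  next
    case True
    define t where "t = Re z"
    have zt: "z = of_real t"
      using True by (simp add: t_def complex_eq_iff)
    have t: "t > 0 \<or> t < -1"
    proof (rule ccontr)
      assume "\<not> ?thesis"
      then have "- t \<in> {0..1}" "z = - of_real (- t)"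
        by (auto simp: zt)
      with z show False by blast
    qed
    have h: "h = of_real (\<Sum>i\<in>I. e i / (t + a i))"
      by (simp add: h_def zt)
    from t have "(\<Sum>i\<in>I. e i / (t + a i)) \<noteq> 0"
    proof
      assume "t > 0"
      with a have pos: "t + a i > 0" if "i \<in> I" for i
        using that by (simp add: add_pos_nonneg)
      then have "(\<Sum>i\<in>I. e i / (t + a i)) > 0"
        using \<open>finite I\<close> i0 e(1) by (intro sum_pos2[of _ i0]) (auto intro!: divide_nonneg_pos)
      then show ?thesis by simp
    next
      assume "t < -1"
      with a have neg: "t + a i < 0" if "i \<in> I" for i
        using that by fastforce
      have "(\<Sum>i\<in>I. - (e i / (t + a i))) > 0"
        using \<open>finite I\<close> i0 e(1) neg
        by (intro sum_pos2[of _ i0]) (auto intro!: divide_pos_neg divide_nonneg_neg)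
      then show ?thesis by (simp add: sum_negf)
    qed
    then show ?thesis
      unfolding h by (simp only: of_real_eq_0_iff not_False_eq_True)
  qed
  moreover have "z \<noteq> 0"
  proof
    assume "z = 0"
    then have "(0::real) \<in> {0..1} \<and> z = - of_real 0" by simp
    with z show False by blast
  qed
  moreover have "(\<Sum>i\<in>I. e i * (z / (z + a i))) = z * h"
    by (simp add: h_def sum_distrib_left mult_ac)
  ultimately show ?thesis by simp
qed

lemma double_sum_nonneg_eq_0:
  fixes f :: "'i \<Rightarrow> 'i \<Rightarrow> real"
  assumes "finite I" and nonneg: "\<And>i j. i \<in> I \<Longrightarrow> j \<in> I \<Longrightarrow> f i j \<ge> 0"
    and "(\<Sum>i\<in>I. \<Sum>j\<in>I. f i j) = 0" and "i \<in> I" "j \<in> I"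
  shows "f i j = 0"
proof -
  have "f i j \<le> (\<Sum>j\<in>I. f i j)"
    using assms by (intro member_le_sum) auto
  also have "\<dots> \<le> (\<Sum>i\<in>I. \<Sum>j\<in>I. f i j)"
    using assms by (intro member_le_sum[where f = "\<lambda>i. \<Sum>j\<in>I. f i j"] sum_nonneg) auto
  finally show ?thesis
    using assms by (simp add: order_antisym)
qed

text \<open>For nonreal \<open>z\<close>, a zero would make
  \<open>(1 - z\<^sup>2) * ?k' * cnj ?k\<close> real, so every pair contribution vanishes. This
  leaves only terms with \<open>e i = 0\<close> or \<open>a i = 0\<close>, hence
  \<open>?k' = 0\<close>, and then \<open>?k = 0\<close> contradicts
  \<open>stieltjes_sum_nonzero\<close>.\<close>

lemma turan_factor_nonzero:
  fixes e a :: "'i \<Rightarrow> real" and z :: complex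
  assumes "finite I" and e: "\<And>i. i \<in> I \<Longrightarrow> e i \<ge> 0" "\<exists>i\<in>I. e i > 0"
    and a: "\<And>i. i \<in> I \<Longrightarrow> a i \<in> {0..1}" and z: "Re z > 0"
  shows "(\<Sum>i\<in>I. e i * (z / (z + a i))) + (1 - z\<^sup>2) * (\<Sum>i\<in>I. e i * (a i / (z + a i)\<^sup>2)) \<noteq> 0"
    (is "?k + _ * ?k' \<noteq> 0")
proof (cases "Im z = 0")
  case True
  define t where "t = Re z"
  have zt: "z = of_real t" and t: "t > 0"
    using True z by (simp_all add: t_def complex_eq_iff)
  obtain i0 where i0: "i0 \<in> I" "e i0 > 0"
    using e(2) by blast
  \<comment> \<open>The numerator is \<open>t * (t + a i) + (1 - t\<^sup>2) * a i\<close>; grouped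
    this way, it is visibly positive because \<open>a i \<le> 1\<close>.\<close>
  define w where "w i = ((1 - a i) * t\<^sup>2 + a i * t + a i) / (t + a i)\<^sup>2" for i
  have w: "w i > 0" if "i \<in> I" for i
  proof -
    have "t + a i > 0"
      using t a[OF that] by simp
    moreover have "(1 - a i) * t\<^sup>2 + a i * t + a i > 0"
    proof (cases "a i = 0")
      case False
      with a[OF that] t show ?thesis by (simp add: add_nonneg_pos)
    qed (use t in simp)
    ultimately show ?thesis by (simp add: w_def)
  qed
  have term_eq: "e i * (t / (t + a i)) + (1 - t\<^sup>2) * (e i * (a i / (t + a i)\<^sup>2)) = e i * w i"
    if "i \<in> I" for i
  proof -
    have "t + a i \<noteq> 0"
      using t a[OF that] by simp
    then show ?thesis
      by (simp add: w_def divide_simps) (simp add: algebra_simps power2_eq_square)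
  qed
  have "?k + (1 - z\<^sup>2) * ?k' = of_real ((\<Sum>i\<in>I. e i * (t / (t + a i)))
      + (1 - t\<^sup>2) * (\<Sum>i\<in>I. e i * (a i / (t + a i)\<^sup>2)))"
    by (simp add: zt)
  also have "\<dots> = of_real (\<Sum>i\<in>I. e i * w i)"
    unfolding sum_distrib_left sum.distrib[symmetric] using term_eq by (simp cong: sum.cong)
  finally have "?k + (1 - z\<^sup>2) * ?k' = of_real (\<Sum>i\<in>I. e i * w i)" .
  moreover have "(\<Sum>i\<in>I. e i * w i) > 0"
    using \<open>finite I\<close> i0 e(1) w by (intro sum_pos2[of _ i0]) (auto intro!: mult_nonneg_nonneg intro: less_imp_le)
  ultimately show ?thesis
    by (simp only: of_real_eq_0_iff)
next
  case False
  have "?k \<noteq> 0"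
  proof (rule stieltjes_sum_nonzero)
    show "\<nexists>t. t \<in> {0..1} \<and> z = - complex_of_real t"
      using z by auto
  qed (use assms in auto)
  show ?thesis
  proof
    assume *: "?k + (1 - z\<^sup>2) * ?k' = 0"
    define J where "J i j = Im z * Im (cross_term z (a i) (a j) + cross_term z (a j) (a i))" for i j
    define X where "X = (\<Sum>i\<in>I. \<Sum>j\<in>I. e i * e j * cross_term z (a i) (a j))"
    have J: "J i j \<le> 0" if "i \<in> I" "j \<in> I" for i j
    proof (cases "a i \<noteq> 0 \<or> a j \<noteq> 0")
      case True
      then show ?thesis
        unfolding J_def using cross_term_sym_neg[of z "a i" "a j"] z False that a by fastforce
    qed (simp add: J_def cross_term_def)
    have "?k' * cnj ?k =
        (\<Sum>i\<in>I. \<Sum>j\<in>I. (e i * (a i / (z + a i)\<^sup>2)) * cnj (e j * (z / (z + a j))))"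
      by (simp only: cnj_sum sum_product)
    then have "X = (1 - z\<^sup>2) * (?k' * cnj ?k)"
      by (simp add: X_def cross_term_def sum_distrib_left mult_ac)
    also have "\<dots> = - (?k * cnj ?k)"
      using * by (simp add: add_eq_0_iff2)
    finally have X0: "Im X = 0"
      by (simp only: complex_mult_cnj Im_complex_of_real uminus_complex.sel neg_equal_0_iff_equal)
    \<comment> \<open>Averaging \<open>X\<close> with its index-swapped form produces the symmetric
      pairs whose sign is known.\<close>
    have X_swap: "X = (\<Sum>i\<in>I. \<Sum>j\<in>I. e i * e j * cross_term z (a j) (a i))"
      unfolding X_def by (subst sum.swap) (simp only: mult.commute)
    have "X + X = (\<Sum>i\<in>I. \<Sum>j\<in>I. e i * e j * cross_term z (a i) (a j))
        + (\<Sum>i\<in>I. \<Sum>j\<in>I. e i * e j * cross_term z (a j) (a i))"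
      by (simp only: X_def[symmetric] X_swap[symmetric])
    also have "\<dots> = (\<Sum>i\<in>I. \<Sum>j\<in>I. e i * e j * (cross_term z (a i) (a j) + cross_term z (a j) (a i)))"
      by (simp only: sum.distrib distrib_left)
    finally have "X + X = (\<Sum>i\<in>I. \<Sum>j\<in>I. e i * e j * (cross_term z (a i) (a j) + cross_term z (a j) (a i)))" .
    then have "Im z * Im (X + X) = (\<Sum>i\<in>I. \<Sum>j\<in>I. e i * e j * J i j)"
      by (simp add: J_def sum_distrib_left mult_ac)
    then have sum0: "(\<Sum>i\<in>I. \<Sum>j\<in>I. - (e i * e j * J i j)) = 0"
      using X0 by (simp add: sum_negf)
    have nonneg: "- (e i * e j * J i j) \<ge> 0" if "i \<in> I" "j \<in> I" for i j
      using J[OF that] e(1) that by (simp add: mult_nonneg_nonpos)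
    have zero: "- (e i * e j * J i j) = 0" if "i \<in> I" "j \<in> I" for i j
      using \<open>finite I\<close> nonneg sum0 that by (rule double_sum_nonneg_eq_0)
    \<comment> \<open>The diagonal pair \<open>{i, i}\<close> suffices: \<open>J i i\<close> is
      strictly negative when \<open>a i \<noteq> 0\<close>.\<close>
    have "e i * (a i / (z + a i)\<^sup>2) = 0" if "i \<in> I" for i
    proof (rule ccontr)
      assume "\<not> ?thesis"
      then have "e i \<noteq> 0" "a i \<noteq> 0" by auto
      moreover from this have "J i i < 0"
        unfolding J_def using cross_term_sym_neg[of z "a i" "a i"] z False that a by fastforce
      ultimately show False
        using zero[OF that that] by simp
    qed
    then have "?k' = 0" by (intro sum.neutral) simp
    with * \<open>?k \<noteq> 0\<close> show False by simp
  qed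
qed

section \<open>Factorisation of the alternating runs polynomials\<close>

text \<open>All factors of the recurrence are nonnegative for \<open>k < n\<close>, and for
  \<open>k = n - 1\<close> the middle term carries the previous leading coefficient. This fixes the
  degree of the polynomial.\<close>

lemma alt_runs_sign: "k < n \<Longrightarrow> alt_runs n k \<ge> 0 \<and> (k = n - 1 \<longrightarrow> alt_runs n k > 0)"
proof (induction n k rule: alt_runs.induct)
  case (3 m k)
  show ?case
  proof (cases "k \<le> m")
    case True
    with 3 show ?thesis by auto
  next
    case False
    with 3 show ?thesis by (auto simp: alt_runs_eq_0 less_Suc_eq)
  qed
qed auto

lemma degree_alt_runs_poly: "degree (alt_runs_poly (Suc n)) = n"
proof (rule antisym)
  show "degree (alt_runs_poly (Suc n)) \<le> n"
    by (rule degree_le) (simp add: coeff_alt_runs_poly alt_runs_eq_0)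
  show "n \<le> degree (alt_runs_poly (Suc n))"
    using alt_runs_sign[of n "Suc n"] by (intro le_degree) (simp add: coeff_alt_runs_poly)
qed

text \<open>The index is shifted: \<open>n\<close> is the degree of \<open>R\<^sub>n\<^sub>+\<^sub>1\<close>, so that \<open>e\<close> becomes \<open>2 m + 2 - n\<close>.\<close>

locale alt_runs_factorization =
  fixes n :: nat and c :: complex and m d :: nat and a :: "nat \<Rightarrow> real"
  assumes factorization:
      "alt_runs_poly (n + 1) = smult c ([:1, 1:]^m * (\<Prod>i<d. [:of_real (a i), 1:]))"
    and c_nonzero: "c \<noteq> 0"
    and degrees: "m + d = n" and m_bounds: "2 * m \<le> n" "n \<le> 2 * m + 2"
    and a_unit: "i < d \<Longrightarrow> a i \<in> {0..1}"
begin

text \<open>By \<open>m_bounds\<close> the subtraction does not truncate, and the value is 0, 1 or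
  2.\<close>

definition eps :: nat where "eps = 2 * m + 2 - n"

definition cofactor :: "nat \<Rightarrow> complex poly" where
  "cofactor i = (\<Prod>j\<in>{..<d} - {i}. [:of_real (a j), 1:])"

text \<open>This is \<open>(1 + x) * k\<close> times the product of the \<open>x + a i\<close>, with
  denominators cleared.\<close>

definition G :: "complex poly" where
  "G = smult (of_nat eps) ([:0, 1:] * (\<Prod>i<d. [:of_real (a i), 1:]))
     + [:0, 1, 1:] * (\<Sum>i<d. smult (1 + of_real (a i)) (cofactor i))"

lemma poly_cofactor:
  assumes "i < d"
  shows "(z + of_real (a i)) * poly (cofactor i) z = poly (\<Prod>j<d. [:of_real (a j), 1:]) z"
proof -
  have "(\<Prod>j<d. [:complex_of_real (a j), 1:]) = [:of_real (a i), 1:] * cofactor i"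
    unfolding cofactor_def using assms by (subst prod.remove[of _ i]) auto
  then have "poly (\<Prod>j<d. [:complex_of_real (a j), 1:]) z = poly ([:of_real (a i), 1:] * cofactor i) z"
    by (rule arg_cong)
  also have "\<dots> = (z + of_real (a i)) * poly (cofactor i) z"
    by (simp add: algebra_simps)
  finally show ?thesis ..
qed

lemma next_factorization: "alt_runs_poly (n + 2) = smult c ([:1, 1:]^m * G)"
proof -
  have "poly (alt_runs_poly (n + 2)) z = poly (smult c ([:1, 1:]^m * G)) z" for z
  proof -
    define p where "p = poly (\<Prod>i<d. [:complex_of_real (a i), 1:]) z"
    define S where "S = (\<Sum>i<d. poly (cofactor i) z)"
    define A where "A = (\<Sum>i<d. (1 + of_real (a i)) * poly (cofactor i) z)"
    define M where "M = (1 + z)^m"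
    have eps: "(of_nat eps :: complex) = of_nat m + 2 - of_nat d"
    proof -
      have "eps + d = m + 2"
        using degrees m_bounds by (simp add: eps_def)
      then show ?thesis
        by (metis add_diff_cancel_right' of_nat_add of_nat_numeral)
    qed
    \<comment> \<open>The truncated exponent for \<open>m = 0\<close> is harmless because of the
      factor \<open>of_nat m\<close>.\<close>
    have dM: "(1 - z\<^sup>2) * (of_nat m * (1 + z)^(m - 1)) = (1 - z) * of_nat m * M"
      by (cases m) (simp_all add: M_def algebra_simps power2_eq_square)
    \<comment> \<open>Splitting \<open>1 - z = (1 + a i) - (z + a i)\<close> is what produces the
      weights \<open>1 + a i\<close>.\<close>
    have "(1 - z) * S = (\<Sum>i<d. (1 + of_real (a i)) * poly (cofactor i) z - p)"
      unfolding S_def sum_distrib_left p_def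
      by (intro sum.cong refl) (simp add: algebra_simps flip: poly_cofactor)
    then have S: "(1 - z) * S = A - of_nat d * p"
      by (simp add: A_def sum_subtractf)
    have f: "poly (alt_runs_poly (n + 1)) z = c * (M * p)"
      by (simp only: factorization) (simp add: M_def p_def)
    have f': "poly (pderiv (alt_runs_poly (n + 1))) z = c * (of_nat m * (1 + z)^(m - 1) * p + M * S)"
      by (simp only: factorization)
         (simp add: pderiv_smult pderiv_mult pderiv_power pderiv_prod pderiv_pCons
            cofactor_def poly_sum p_def M_def S_def algebra_simps)
    have "poly (alt_runs_poly (n + 2)) z =
       z * (2 + of_nat n * z) * (c * (M * p))
       + z * (1 - z\<^sup>2) * (c * (of_nat m * (1 + z)^(m - 1) * p + M * S))"
      unfolding alt_runs_poly_rec poly_add poly_mult f f'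
      by (simp add: algebra_simps power2_eq_square)
    also have "\<dots> = c * z * (M * p * (2 + of_nat n * z)
       + p * ((1 - z\<^sup>2) * (of_nat m * (1 + z)^(m - 1))) + M * (1 + z) * ((1 - z) * S))"
      by (simp add: algebra_simps power2_eq_square)
    also have "\<dots> = c * M * (of_nat eps * z * p + z * (1 + z) * A)"
      unfolding dM S eps by (simp add: algebra_simps flip: degrees)
    also have "\<dots> = poly (smult c ([:1, 1:]^m * G)) z"
      by (simp add: G_def M_def p_def A_def poly_sum algebra_simps)
    finally show ?thesis .
  qed
  then show ?thesis
    by (simp add: poly_eq_poly_eq_iff[symmetric] fun_eq_iff)
qed

section \<open>The quotient of consecutive polynomials as a sum of simple fractions\<close>

definition weight :: "nat \<Rightarrow> real" where
  "weight i = (if i < d then 1 + a i else real eps)"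

text \<open>Index \<open>d\<close> represents the factor \<open>1 + x\<close>, with node 1 and
  weight \<open>eps\<close>, so that \<open>k\<close> is a single sum.\<close>

definition node :: "nat \<Rightarrow> real" where
  "node i = (if i < d then a i else 1)"

definition k :: "complex \<Rightarrow> complex" where
  "k z = (\<Sum>i<Suc d. of_real (weight i) * (z / (z + of_real (node i))))"

lemma weight_nonneg: "weight i \<ge> 0"
  using a_unit[of i] by (auto simp: weight_def)

lemma weight_pos: "\<exists>i\<in>{..<Suc d}. weight i > 0"
proof (cases "d = 0")
  case True
  then have "eps > 0" unfolding eps_def using degrees by simp
  with True have "weight 0 > 0" unfolding weight_def by simp
  then show ?thesis by blast
next
  case False
  then show ?thesis using a_unit[of 0] by (intro bexI[of _ 0]) (auto simp: weight_def)
qed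

lemma node_unit: "node i \<in> {0..1}"
  using a_unit[of i] by (auto simp: node_def)

lemma weight_node_last [simp]: "node d = 1" "weight d = real eps"
  by (simp_all add: node_def weight_def)

lemma poly_next:
  assumes "\<And>i. z + of_real (node i) \<noteq> 0"
  shows "poly (alt_runs_poly (n + 2)) z = (1 + z) * k z * poly (alt_runs_poly (n + 1)) z"
proof -
  define p where "p = poly (\<Prod>i<d. [:complex_of_real (a i), 1:]) z"
  have z1: "1 + z \<noteq> 0"
    using assms[of d] by (simp add: add.commute)
  have cof: "poly (cofactor i) z = p / (z + of_real (a i))" if "i < d" for i
    using poly_cofactor[OF that, of z] assms[of i] that
    by (simp add: p_def node_def field_simps)
  have "poly G z = of_nat eps * z * p
      + z * (1 + z) * (\<Sum>i<d. (1 + of_real (a i)) * (p / (z + of_real (a i))))"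
    by (simp add: G_def p_def[symmetric] poly_sum cof algebra_simps)
  also have "(\<Sum>i<d. (1 + of_real (a i)) * (p / (z + of_real (a i))))
      = p * (\<Sum>i<d. (1 + of_real (a i)) * (1 / (z + of_real (a i))))"
    by (simp add: sum_distrib_left algebra_simps)
  also have "of_nat eps * z * p + z * (1 + z) * \<dots> = (1 + z) * k z * p"
    using z1 by (simp add: k_def weight_def node_def sum_distrib_left field_simps)
  finally have "poly G z = (1 + z) * k z * p" .
  then show ?thesis
    by (simp only: next_factorization factorization) (simp add: p_def)
qed

section \<open>Location of the zeros and inheritance of the factorization\<close>

lemma roots_alt_runs_poly:
  assumes "poly (alt_runs_poly (n + 1)) z = 0"
  shows "\<exists>t. t \<in> {0..1} \<and> z = - complex_of_real t"
proof -
  have "(1 + z)^m = 0 \<or> (\<exists>i<d. of_real (a i) + z = 0)"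
    using assms c_nonzero by (simp only: factorization) (auto simp: poly_prod)
  then consider "z = - complex_of_real 1" | i where "i < d" "z = - complex_of_real (a i)"
    by (auto simp: add_eq_0_iff)
  then show ?thesis
    using a_unit by cases (force, blast)
qed

text \<open>All nodes give poles in [-1, 0], so elsewhere \<open>poly_next\<close> applies and none
  of its three factors vanishes.\<close>

lemma roots_next:
  assumes "poly (alt_runs_poly (n + 2)) z = 0"
  shows "\<exists>t. t \<in> {0..1} \<and> z = - complex_of_real t"
proof (rule ccontr)
  assume *: "\<not> ?thesis"
  have nz: "z + of_real (node i) \<noteq> 0" for i
    using * node_unit by (metis eq_neg_iff_add_eq_0)
  have "k z \<noteq> 0"
    unfolding k_def using weight_nonneg weight_pos node_unit *
    by (intro stieltjes_sum_nonzero) auto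
  moreover have "1 + z \<noteq> 0"
    using nz[of d] by (simp add: add.commute)
  moreover have "poly (alt_runs_poly (n + 1)) z \<noteq> 0"
    using * roots_alt_runs_poly by blast
  ultimately show False
    using poly_next[OF nz] assms by simp
qed

lemma factorization_next: "\<exists>c m d a. alt_runs_factorization (n + 1) c m d a"
proof -
  obtain m' H where H: "alt_runs_poly (n + 2) = [:1, 1:]^m' * H"
    and m': "2 * m' \<le> n + 1" "n + 1 \<le> 2 * m' + 2"
  \<comment> \<open>If \<open>eps = 0\<close>, then \<open>n = 2 * m + 2\<close> and the old
    \<open>m\<close> would break the upper bound for \<open>n + 1\<close>; but then \<open>G\<close>
    supplies another factor \<open>1 + x\<close>. Otherwise \<open>m\<close> can be kept.\<close>
  proof (cases "eps = 0")
    case True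
    have "[:0, 1, 1:] = [:1, 1:] * [:0, 1 :: complex:]" by simp
    then have "G = [:1, 1:] * ([:0, 1:] * (\<Sum>i<d. smult (1 + of_real (a i)) (cofactor i)))"
      unfolding G_def True by (simp only: mult.assoc) simp
    then have "alt_runs_poly (n + 2) =
        [:1, 1:]^Suc m * smult c ([:0, 1:] * (\<Sum>i<d. smult (1 + of_real (a i)) (cofactor i)))"
      by (simp only: next_factorization power_Suc mult_smult_right mult_ac)
    then show ?thesis
      using True m_bounds by (intro that[of "Suc m"]) (assumption, auto simp: eps_def)
  next
    case False
    then show ?thesis
      using next_factorization m_bounds
      by (intro that[of m "smult c G"]) (auto simp: eps_def)
  qed
  have R0: "alt_runs_poly (n + 2) \<noteq> 0"
    using degree_alt_runs_poly[of "n + 1"] by auto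
  then have "H \<noteq> 0" using H by auto
  have "degree (alt_runs_poly (n + 2)) = m' + degree H"
    unfolding H using \<open>H \<noteq> 0\<close> by (simp add: degree_mult_eq degree_power_eq)
  then have deg: "m' + degree H = n + 1"
    using degree_alt_runs_poly[of "n + 1"] by simp
  obtain A where A: "size A = degree H" "H = smult (lead_coeff H) (\<Prod>x\<in>#A. [:-x, 1:])"
    using alg_closed_imp_factorization[OF \<open>H \<noteq> 0\<close>] by blast
  obtain xs where xs: "mset xs = A"
    using ex_mset by blast
  have len: "length xs = degree H"
    using A(1) xs by auto
  \<comment> \<open>By \<open>roots_next\<close> the roots are real, so taking the real part loses
    nothing.\<close>
  define b where "b i = - Re (xs ! i)" for i
  have b: "b i \<in> {0..1} \<and> xs ! i = - complex_of_real (b i)" if "i < degree H" for i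
  proof -
    have "xs ! i \<in># A"
      using that len by (auto simp: xs[symmetric])
    then have "poly H (xs ! i) = 0"
      by (subst A(2)) (auto simp: poly_prod_mset image_image prod_mset_zero_iff)
    then have "poly (alt_runs_poly (n + 2)) (xs ! i) = 0"
      by (simp only: H) simp
    then show ?thesis
      using roots_next by (fastforce simp: b_def)
  qed
  have "(\<Prod>x\<in>#A. [:-x, 1:]) = prod_list (map (\<lambda>x. [:-x, 1:]) xs)"
    by (simp add: xs[symmetric] prod_mset_prod_list flip: mset_map)
  also have "\<dots> = (\<Prod>i<degree H. [:- (xs ! i), 1:])"
    by (simp add: prod.list_conv_set_nth atLeast0LessThan len)
  also have "\<dots> = (\<Prod>i<degree H. [:of_real (b i), 1:])"
    using b by (intro prod.cong) (auto)
  finally have "alt_runs_poly (n + 2) =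
      smult (lead_coeff H) ([:1, 1:]^m' * (\<Prod>i<degree H. [:of_real (b i), 1:]))"
    using A(2) H by (metis mult_smult_right)
  then have "alt_runs_factorization (n + 1) (lead_coeff H) m' (degree H) b"
    using \<open>H \<noteq> 0\<close> deg m' b by unfold_locales (simp_all add: numeral_2_eq_2)
  then show ?thesis by blast
qed

section \<open>The Turan expression in the right half-plane\<close>

lemma poly_turan_nonzero:
  assumes z: "Re z > 0"
  shows "poly ((alt_runs_poly (n + 2))\<^sup>2 - alt_runs_poly (n + 3) * alt_runs_poly (n + 1)) z \<noteq> 0"
proof -
  define f where "f = poly (alt_runs_poly (n + 1)) z"
  define g where "g = poly (alt_runs_poly (n + 2)) z"
  define f' where "f' = poly (pderiv (alt_runs_poly (n + 1))) z"
  define g' where "g' = poly (pderiv (alt_runs_poly (n + 2))) z"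
  define k' where "k' = (\<Sum>i<Suc d. of_real (weight i) * (of_real (node i) / (z + of_real (node i))\<^sup>2))"
  have nz: "w + of_real (node i) \<noteq> 0" if "Re w > 0" for w i
    using add_of_real_nonzero[OF that] node_unit by simp
  have "((\<lambda>w. of_real u * (w / (w + of_real t))) has_field_derivative
      of_real u * (of_real t / (z + of_real t)\<^sup>2)) (at z)"
    if "z + of_real t \<noteq> 0" for u t :: real
    using that by (auto intro!: derivative_eq_intros simp: power2_eq_square algebra_simps)
  then have dk: "(k has_field_derivative k') (at z)"
    unfolding k_def k'_def using nz[OF z] by (intro DERIV_sum) simp
  have open_half: "open {w. Re w > 0}"
    by (rule open_Collect_less) (auto intro: continuous_intros)
  have "((\<lambda>w. (1 + w) * k w * poly (alt_runs_poly (n + 1)) w) has_field_derivative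
          k z * f + (1 + z) * k' * f + (1 + z) * k z * f') (at z)"
    by (rule DERIV_cong[OF DERIV_mult[OF DERIV_mult[OF DERIV_add[OF DERIV_const DERIV_ident] dk] poly_DERIV]])
       (simp add: f_def f'_def algebra_simps)
  \<comment> \<open>The product formula holds only away from the nodes, so the derivative is
    transferred on the open half-plane.\<close>
  then have "(poly (alt_runs_poly (n + 2)) has_field_derivative
          k z * f + (1 + z) * k' * f + (1 + z) * k z * f') (at z)"
    by (rule has_field_derivative_transform_within_open[OF _ open_half])
       (use z poly_next[OF nz] in simp_all)
  then have g': "g' = k z * f + (1 + z) * k' * f + (1 + z) * k z * f'"
    using poly_DERIV DERIV_unique unfolding g'_def by blast
  have g1: "g = (1 + z) * k z * f"
    using poly_next nz[OF z] by (simp add: f_def g_def)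
  have g2: "g = (2*z + of_nat n * z\<^sup>2) * f + z * (1 - z\<^sup>2) * f'"
    unfolding g_def alt_runs_poly_rec by (simp add: f_def f'_def algebra_simps power2_eq_square)
  have h: "poly (alt_runs_poly (n + 3)) z = (2*z + (of_nat n + 1) * z\<^sup>2) * g + z * (1 - z\<^sup>2) * g'"
    using alt_runs_poly_rec[of "n + 1"]
    by (simp add: g_def g'_def algebra_simps power2_eq_square numeral_3_eq_3 numeral_2_eq_2)
  have "poly ((alt_runs_poly (n + 2))\<^sup>2 - alt_runs_poly (n + 3) * alt_runs_poly (n + 1)) z
      = g\<^sup>2 - poly (alt_runs_poly (n + 3)) z * f"
    by (simp add: f_def g_def)
  also have "\<dots> = - z * (1 + z) * f\<^sup>2 * (k z + (1 - z\<^sup>2) * k')"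
  proof -
    \<comment> \<open>The recurrence \<open>g2\<close> eliminates \<open>f'\<close>; with
      \<open>g1\<close>, the last term contributes a \<open>g\<^sup>2\<close> that cancels in the
      Turan expression.\<close>
    have dg: "z * (1 - z\<^sup>2) * g' = z * (1 - z\<^sup>2) * (k z + (1 + z) * k') * f
        + (1 + z) * k z * (g - (2*z + of_nat n * z\<^sup>2) * f)"
      unfolding g' g2 by (simp add: algebra_simps)
    then show ?thesis
      unfolding h dg by (simp add: g1 algebra_simps power2_eq_square)
  qed
  also have "\<dots> \<noteq> 0"
  proof -
    have "f \<noteq> 0"
      unfolding f_def using roots_alt_runs_poly[of z] z by auto
    moreover have "z \<noteq> 0" "1 + z \<noteq> 0"
      using z add_of_real_nonzero[OF z, of 1] by (auto simp: add.commute)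
    moreover have "k z + (1 - z\<^sup>2) * k' \<noteq> 0"
      unfolding k_def k'_def using weight_nonneg weight_pos node_unit z
      by (intro turan_factor_nonzero) auto
    ultimately show ?thesis by simp
  qed
  finally show ?thesis .
qed

end

lemma alt_runs_factorization_exists: "\<exists>c m d a. alt_runs_factorization n c m d a"
proof (induction n)
  case 0
  have "alt_runs_factorization 0 1 0 0 (\<lambda>_. 0)"
    by unfold_locales (use alt_runs_poly_1 in simp_all)
  then show ?case by blast
next
  case (Suc n)
  then show ?case
    using alt_runs_factorization.factorization_next by fastforce
qed

theorem proposition3p8:
  fixes n :: nat
  assumes "n \<ge> 1"
  shows "hurwitz_stable ((alt_runs_poly (n + 1))\<^sup>2 - alt_runs_poly (n + 2) * alt_runs_poly n)"
proof -
  \<comment> \<open>The locale is indexed by the degree, which is \<open>n - 1\<close> for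
    \<open>alt_runs_poly n\<close>.\<close>
  obtain c m d a where "alt_runs_factorization (n - 1) c m d a"
    using alt_runs_factorization_exists by blast
  then show ?thesis
    using alt_runs_factorization.poly_turan_nonzero[of "n - 1"] assms
    by (auto simp: hurwitz_stable_def numeral_3_eq_3)
qed

end
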